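(* Let $I$ be a set and $\langle F_i \rangle_{i \in I}$ a family of taut functors $\mathbf{Set} \to \mathbf{Set}$. Then there is an isomorphism of functors $$\Delta\Bigl[\prod_{i \in I} F_i\Bigr] \cong \sum_{J \subsetneq I} \Bigl(\prod_{j \in J} F_j\Bigr) \times \Bigl(\prod_{k \notin J} \Delta[F_k]\Bigr),$$ where the sum is taken over all proper subsets $J$ of $I$.
   Context: A functor is taut if it preserves inverse image diagrams, i.e. pullback squares in which one leg is a monomorphism (pullbacks of a monomorphism along an arbitrary morphism). Products of taut functors are taut. For a taut functor $F \colon \mathbf{Set} \to \mathbf{Set}$ let $j_X \colon X \to X+1$ be the coproduct injection. The difference functor of $F$ is $\Delta[F](X) = F(X+1) \setminus \mathrm{Im}\, F(j_X)$; for $f \colon X \to Y$, $\Delta[F](f)$ is the restriction of $F(f+1)$ (which does restrict, because $F$ is taut). Products and coproducts of functors are pointwise; $\sum$ denotes coproduct. *)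

theory Defs
  imports "HOL-Library.FuncSet" "HOL-Library.Infinite_Typeclass"
begin

text \<open>
  The category of sets is modelled by a universe \<open>U\<close> of subsets of an infinite type: its objects
  are the members of \<open>U\<close>, its morphisms \<open>X \<rightarrow> Y\<close> are the extensional functions in \<open>X \<rightarrow>\<^sub>E Y\<close>, and
  composition and identities are \<^const>\<open>compose\<close> and \<open>restrict id X\<close>. Besides \<^const>\<open>UNIV\<close> (all
  subsets of the type), the small subsets of a type carrying a model of set theory form such a
  universe.
\<close>

definition set_universe :: "'a set set \<Rightarrow> bool" where
  "set_universe U \<longleftrightarrow>
     (\<forall>x. {x} \<in> U) \<and>
     (\<forall>X\<in>U. \<forall>Y. Y \<subseteq> X \<longrightarrow> Y \<in> U) \<and>
     (\<forall>X\<in>U. \<forall>Y\<in>U. X \<union> Y \<in> U) \<and>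
     (\<forall>X\<in>U. \<forall>h :: 'a \<Rightarrow> 'a. h ` X \<in> U)"

lemma set_universe_UNIV: "set_universe UNIV"
  by (simp add: set_universe_def)

text \<open>
  The target of a functor is the category of all subsets of a second type \<open>'b\<close>, which may differ
  from \<open>'a\<close>: a product over \<open>I\<close> of sets over \<open>'b\<close> is a set over \<open>'i \<Rightarrow> 'b\<close>. The action on morphisms
  takes domain and codomain as arguments, since a function does not determine its codomain.
\<close>

record ('a, 'b) set_functor =
  fobj :: "'a set \<Rightarrow> 'b set"
  fmap :: "'a set \<Rightarrow> 'a set \<Rightarrow> ('a \<Rightarrow> 'a) \<Rightarrow> 'b \<Rightarrow> 'b"

definition is_functor :: "'a set set \<Rightarrow> ('a, 'b) set_functor \<Rightarrow> bool" where
  "is_functor U F \<longleftrightarrow>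
     (\<forall>X\<in>U. \<forall>Y\<in>U. \<forall>f \<in> X \<rightarrow>\<^sub>E Y. fmap F X Y f \<in> fobj F X \<rightarrow>\<^sub>E fobj F Y) \<and>
     (\<forall>X\<in>U. fmap F X X (restrict id X) = restrict id (fobj F X)) \<and>
     (\<forall>X\<in>U. \<forall>Y\<in>U. \<forall>Z\<in>U. \<forall>f \<in> X \<rightarrow>\<^sub>E Y. \<forall>g \<in> Y \<rightarrow>\<^sub>E Z.
        fmap F X Z (compose X g f) = compose (fobj F X) (fmap F Y Z g) (fmap F X Y f))"

text \<open>
  Isomorphism of functors; the two target categories may be sets over different types, so an
  isomorphism of sets is a bijection.
\<close>

definition functors_isomorphic ::
  "'a set set \<Rightarrow> ('a, 'b) set_functor \<Rightarrow> ('a, 'c) set_functor \<Rightarrow> bool" where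
  "functors_isomorphic U F G \<longleftrightarrow>
     is_functor U F \<and> is_functor U G \<and>
     (\<exists>\<eta>. (\<forall>X\<in>U. bij_betw (\<eta> X) (fobj F X) (fobj G X)) \<and>
          (\<forall>X\<in>U. \<forall>Y\<in>U. \<forall>f \<in> X \<rightarrow>\<^sub>E Y. \<forall>x \<in> fobj F X.
             \<eta> Y (fmap F X Y f x) = fmap G X Y f (\<eta> X x)))"

text \<open>
  The square with \<open>p : P \<rightarrow> A\<close>, \<open>q : P \<rightarrow> B\<close>, \<open>f : A \<rightarrow> C\<close>, \<open>g : B \<rightarrow> C\<close> is a pullback, with test
  objects ranging over the objects \<open>U\<close> of the category.
\<close>

definition is_pullback ::
  "'a set set \<Rightarrow> 'a set \<Rightarrow> 'a set \<Rightarrow> 'a set \<Rightarrow> 'a set \<Rightarrow>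
   ('a \<Rightarrow> 'a) \<Rightarrow> ('a \<Rightarrow> 'a) \<Rightarrow> ('a \<Rightarrow> 'a) \<Rightarrow> ('a \<Rightarrow> 'a) \<Rightarrow> bool" where
  "is_pullback U P A B C p q f g \<longleftrightarrow>
     p \<in> P \<rightarrow>\<^sub>E A \<and> q \<in> P \<rightarrow>\<^sub>E B \<and> f \<in> A \<rightarrow>\<^sub>E C \<and> g \<in> B \<rightarrow>\<^sub>E C \<and>
     compose P f p = compose P g q \<and>
     (\<forall>T\<in>U. \<forall>a \<in> T \<rightarrow>\<^sub>E A. \<forall>b \<in> T \<rightarrow>\<^sub>E B. compose T f a = compose T g b \<longrightarrow>
        (\<exists>!h. h \<in> T \<rightarrow>\<^sub>E P \<and> compose T p h = a \<and> compose T q h = b))"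

definition taut :: "'a set set \<Rightarrow> ('a, 'b) set_functor \<Rightarrow> bool" where
  "taut U F \<longleftrightarrow>
     is_functor U F \<and>
     (\<forall>P\<in>U. \<forall>A\<in>U. \<forall>B\<in>U. \<forall>C\<in>U. \<forall>p q f m.
        is_pullback U P A B C p q f m \<and> inj_on m B \<longrightarrow>
        is_pullback UNIV (fobj F P) (fobj F A) (fobj F B) (fobj F C)
          (fmap F P A p) (fmap F P B q) (fmap F A C f) (fmap F B C m))"

text \<open>
  To have \<open>X + 1\<close> again over the type \<open>'a\<close>, \<open>'a option\<close> is coded into the infinite type \<open>'a\<close>.
\<close>

definition opt_code :: "'a option \<Rightarrow> 'a::infinite" where
  "opt_code = (SOME c. inj c)"

definition plus_one :: "'a::infinite set \<Rightarrow> 'a set" where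
  "plus_one X = opt_code ` insert None (Some ` X)"

definition plus_one_inj :: "'a::infinite set \<Rightarrow> 'a \<Rightarrow> 'a" where
  "plus_one_inj X = (\<lambda>x\<in>X. opt_code (Some x))"

definition plus_one_map :: "'a::infinite set \<Rightarrow> ('a \<Rightarrow> 'a) \<Rightarrow> 'a \<Rightarrow> 'a" where
  "plus_one_map X f = (\<lambda>z \<in> plus_one X. opt_code (map_option f (inv opt_code z)))"

lemma inj_opt_code: "inj (opt_code :: 'a option \<Rightarrow> 'a::infinite)"
proof -
  obtain h :: "'a \<Rightarrow> 'a" where h: "bij_betw h UNIV (UNIV - {undefined})"
    using infinite_imp_bij_betw[OF infinite_UNIV] by blast
  have "inj (case_option undefined h)"
  proof (rule injI)
    fix x y :: "'a option"
    assume eq: "case_option undefined h x = case_option undefined h y"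
    have "h z \<noteq> undefined" for z
      using bij_betwE[OF h] by auto
    with eq show "x = y"
      using bij_betw_imp_inj_on[OF h] by (cases x; cases y; auto dest: injD; metis)
  qed
  then show ?thesis
    unfolding opt_code_def by (rule someI[where P = inj])
qed

lemma plus_one_in_universe: "set_universe U \<Longrightarrow> X \<in> U \<Longrightarrow> plus_one X \<in> U"
proof -
  assume U: "set_universe U" and X: "X \<in> U"
  have "plus_one X = {opt_code None} \<union> (\<lambda>x. opt_code (Some x)) ` X"
    by (auto simp: plus_one_def)
  with U X show ?thesis
    by (simp add: set_universe_def del: Un_insert_left)
qed

lemma plus_one_map_inj:
  "x \<in> X \<Longrightarrow> plus_one_map X f (plus_one_inj X x) = opt_code (Some (f x))"
  by (simp add: plus_one_map_def plus_one_inj_def plus_one_def inv_f_f[OF inj_opt_code])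

lemma plus_one_map_point: "plus_one_map X f (opt_code None) = opt_code None"
  by (simp add: plus_one_map_def plus_one_def inv_f_f[OF inj_opt_code])

definition difference_functor ::
  "('a::infinite, 'b) set_functor \<Rightarrow> ('a, 'b) set_functor" (\<open>\<Delta>\<close>) where
  "\<Delta> F =
     (let D = (\<lambda>X. fobj F (plus_one X) - fmap F X (plus_one X) (plus_one_inj X) ` fobj F X)
      in \<lparr>fobj = D,
          fmap = (\<lambda>X Y f. restrict (fmap F (plus_one X) (plus_one Y) (plus_one_map X f)) (D X))\<rparr>)"

definition functor_prod ::
  "'i set \<Rightarrow> ('i \<Rightarrow> ('a, 'b) set_functor) \<Rightarrow> ('a, 'i \<Rightarrow> 'b) set_functor" where
  "functor_prod I F =
     \<lparr>fobj = (\<lambda>X. \<Pi>\<^sub>E i\<in>I. fobj (F i) X),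
      fmap = (\<lambda>X Y f. \<lambda>x \<in> (\<Pi>\<^sub>E i\<in>I. fobj (F i) X). \<lambda>i\<in>I. fmap (F i) X Y f (x i))\<rparr>"

definition functor_times ::
  "('a, 'b) set_functor \<Rightarrow> ('a, 'c) set_functor \<Rightarrow> ('a, 'b \<times> 'c) set_functor" where
  "functor_times F G =
     \<lparr>fobj = (\<lambda>X. fobj F X \<times> fobj G X),
      fmap = (\<lambda>X Y f. \<lambda>z \<in> fobj F X \<times> fobj G X. map_prod (fmap F X Y f) (fmap G X Y f) z)\<rparr>"

definition functor_sum ::
  "'k set \<Rightarrow> ('k \<Rightarrow> ('a, 'b) set_functor) \<Rightarrow> ('a, 'k \<times> 'b) set_functor" where
  "functor_sum K G =
     \<lparr>fobj = (\<lambda>X. SIGMA k:K. fobj (G k) X),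
      fmap = (\<lambda>X Y f. \<lambda>(k, x) \<in> (SIGMA k:K. fobj (G k) X). (k, fmap (G k) X Y f x))\<rparr>"

end

theory Submission
  imports Defs
begin

text \<open>
  A point \<open>x\<close> of \<open>\<Prod>F\<^sub>i(X+1)\<close> is sorted by the set \<open>J\<close> of those \<open>i\<close> for which \<open>x\<^sub>i\<close> lies in the
  image of \<open>F\<^sub>i(j\<^sub>X)\<close>; it lies outside the image of \<open>\<Prod>F\<^sub>i(j\<^sub>X)\<close> iff \<open>J \<noteq> I\<close>. Tautness makes
  \<open>F\<^sub>i(j\<^sub>X)\<close> injective, so that on \<open>J\<close> the point \<open>x\<close> amounts to a point of \<open>\<Prod>F\<^sub>j(X)\<close>, and,
  applied to the pullback of \<open>j\<^sub>Y\<close> along \<open>f+1\<close>, it shows that \<open>F\<^sub>i(f+1)\<close> preserves and reflects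
  these images, so that \<open>J\<close> does not change along \<open>f\<close>.
\<close>

section \<open>Functors and pullbacks in terms of elements\<close>

text \<open>The functor laws are equations between extensional functions, so it suffices to compare
  values on \<open>fobj F X\<close>. Extensionality of the left-hand sides comes from the first
  premise, applied to the identity and to the composite.\<close>

lemma is_functorI:
  assumes "\<And>X Y f. X \<in> U \<Longrightarrow> Y \<in> U \<Longrightarrow> f \<in> X \<rightarrow>\<^sub>E Y \<Longrightarrow> fmap F X Y f \<in> fobj F X \<rightarrow>\<^sub>E fobj F Y"
    and "\<And>X x. X \<in> U \<Longrightarrow> x \<in> fobj F X \<Longrightarrow> fmap F X X (restrict id X) x = x"
    and "\<And>X Y Z f g x. X \<in> U \<Longrightarrow> Y \<in> U \<Longrightarrow> Z \<in> U \<Longrightarrow> f \<in> X \<rightarrow>\<^sub>E Y \<Longrightarrow> g \<in> Y \<rightarrow>\<^sub>E Z \<Longrightarrow>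
           x \<in> fobj F X \<Longrightarrow> fmap F X Z (compose X g f) x = fmap F Y Z g (fmap F X Y f x)"
  shows "is_functor U F"
proof -
  have "fmap F X X (restrict id X) = restrict id (fobj F X)" if "X \<in> U" for X
  proof (rule extensionalityI)
    have "restrict id X \<in> X \<rightarrow>\<^sub>E X"
      by simp
    then show "fmap F X X (restrict id X) \<in> extensional (fobj F X)"
      using assms(1)[OF that that] by (auto simp: PiE_def)
  qed (use assms(2) that in auto)
  moreover have "fmap F X Z (compose X g f) = compose (fobj F X) (fmap F Y Z g) (fmap F X Y f)"
    if "X \<in> U" "Y \<in> U" "Z \<in> U" "f \<in> X \<rightarrow>\<^sub>E Y" "g \<in> Y \<rightarrow>\<^sub>E Z" for X Y Z f g
  proof (rule extensionalityI)
    have "compose X g f \<in> X \<rightarrow>\<^sub>E Z"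
      using that by (auto simp: compose_def PiE_iff)
    then show "fmap F X Z (compose X g f) \<in> extensional (fobj F X)"
      using assms(1) that by (auto simp: PiE_def)
  qed (use assms(3) that in \<open>auto simp: compose_def\<close>)
  ultimately show ?thesis
    using assms(1) unfolding is_functor_def by blast
qed

context
  fixes U :: "'a set set" and F :: "('a, 'b) set_functor"
  assumes F: "is_functor U F"
begin

lemma fmap_funcset:
  "X \<in> U \<Longrightarrow> Y \<in> U \<Longrightarrow> f \<in> X \<rightarrow>\<^sub>E Y \<Longrightarrow> fmap F X Y f \<in> fobj F X \<rightarrow>\<^sub>E fobj F Y"
  using F by (simp add: is_functor_def)

lemma fmap_in:
  "X \<in> U \<Longrightarrow> Y \<in> U \<Longrightarrow> f \<in> X \<rightarrow>\<^sub>E Y \<Longrightarrow> x \<in> fobj F X \<Longrightarrow> fmap F X Y f x \<in> fobj F Y"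
  using fmap_funcset by blast

lemma fmap_id: "X \<in> U \<Longrightarrow> x \<in> fobj F X \<Longrightarrow> fmap F X X (restrict id X) x = x"
  using F by (simp add: is_functor_def)

lemma fmap_compose:
  "X \<in> U \<Longrightarrow> Y \<in> U \<Longrightarrow> Z \<in> U \<Longrightarrow> f \<in> X \<rightarrow>\<^sub>E Y \<Longrightarrow> g \<in> Y \<rightarrow>\<^sub>E Z \<Longrightarrow> x \<in> fobj F X \<Longrightarrow>
     fmap F X Z (compose X g f) x = fmap F Y Z g (fmap F X Y f x)"
  using F by (simp add: is_functor_def compose_eq)

end

text \<open>For sets the universal property can be tested on points: the mediating map sends
  \<open>t\<close> to the unique point over \<open>(a t, b t)\<close>, for any test set
  \<open>T\<close>. Restricting it to \<open>T\<close> makes it an extensional function, hence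
  unique as such.\<close>

lemma is_pullbackI:
  assumes "p \<in> P \<rightarrow>\<^sub>E A" "q \<in> P \<rightarrow>\<^sub>E B" "f \<in> A \<rightarrow>\<^sub>E C" "g \<in> B \<rightarrow>\<^sub>E C"
    and comm: "\<And>x. x \<in> P \<Longrightarrow> f (p x) = g (q x)"
    and ex1: "\<And>a b. a \<in> A \<Longrightarrow> b \<in> B \<Longrightarrow> f a = g b \<Longrightarrow> \<exists>!x. x \<in> P \<and> p x = a \<and> q x = b"
  shows "is_pullback U P A B C p q f g"
  unfolding is_pullback_def
proof (intro conjI ballI impI)
  show "compose P f p = compose P g q"
    using comm by (auto simp: compose_def restrict_def)
  fix T a b
  assume a: "a \<in> T \<rightarrow>\<^sub>E A" and b: "b \<in> T \<rightarrow>\<^sub>E B" and eq: "compose T f a = compose T g b"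
  have "\<exists>!x. x \<in> P \<and> p x = a t \<and> q x = b t" if "t \<in> T" for t
    using ex1[of "a t" "b t"] a b that fun_cong[OF eq, of t] by (auto simp: compose_def)
  then obtain h where h: "\<And>t. t \<in> T \<Longrightarrow> h t \<in> P \<and> p (h t) = a t \<and> q (h t) = b t"
    and uniq: "\<And>t x. t \<in> T \<Longrightarrow> x \<in> P \<Longrightarrow> p x = a t \<Longrightarrow> q x = b t \<Longrightarrow> x = h t"
    by metis
  show "\<exists>!h. h \<in> T \<rightarrow>\<^sub>E P \<and> compose T p h = a \<and> compose T q h = b"
  proof (rule ex1I[of _ "restrict h T"], intro conjI)
    show "compose T p (restrict h T) = a" "compose T q (restrict h T) = b"
      using a b h by (auto intro!: extensionalityI[where A = T] simp: compose_def PiE_def)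
    show "restrict h T \<in> T \<rightarrow>\<^sub>E P"
      using h by auto
  next
    fix k
    assume k: "k \<in> T \<rightarrow>\<^sub>E P \<and> compose T p k = a \<and> compose T q k = b"
    show "k = restrict h T"
    proof (rule extensionalityI[where A = T])
      fix t
      assume t: "t \<in> T"
      have "p (k t) = a t" "q (k t) = b t"
        using k t by (auto simp: compose_def)
      with k t uniq show "k t = restrict h T t"
        by auto
    qed (use k in \<open>auto simp: PiE_def\<close>)
  qed
qed (use assms(1-4) in auto)

lemma is_pullback_commute:
  assumes "is_pullback U P A B C p q f g" "x \<in> P"
  shows "f (p x) = g (q x)"
  using assms by (metis compose_eq is_pullback_def)

text \<open>Converse of the pointwise criterion: points of a set are maps from a one-point set
  \<open>T\<close>. A mediating map gives a point, and two points over the same pair give two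
  mediating maps on \<open>T\<close>, which must agree.\<close>

lemma is_pullback_UNIV_ex1:
  assumes pb: "is_pullback UNIV P A B C p q f g"
    and "a \<in> A" "b \<in> B" "f a = g b"
  shows "\<exists>!x. x \<in> P \<and> p x = a \<and> q x = b"
proof -
  define T where "T = {undefined :: 'a}"
  have "(\<lambda>_\<in>T. a) \<in> T \<rightarrow>\<^sub>E A" "(\<lambda>_\<in>T. b) \<in> T \<rightarrow>\<^sub>E B"
    and "compose T f (\<lambda>_\<in>T. a) = compose T g (\<lambda>_\<in>T. b)"
    using assms by (auto simp: compose_def restrict_def)
  with pb have *: "\<exists>!h. h \<in> T \<rightarrow>\<^sub>E P \<and> compose T p h = (\<lambda>_\<in>T. a) \<and> compose T q h = (\<lambda>_\<in>T. b)"
    unfolding is_pullback_def by blast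
  have point: "(\<lambda>_\<in>T. x) \<in> T \<rightarrow>\<^sub>E P \<and> compose T p (\<lambda>_\<in>T. x) = (\<lambda>_\<in>T. a) \<and>
      compose T q (\<lambda>_\<in>T. x) = (\<lambda>_\<in>T. b)" if "x \<in> P" "p x = a" "q x = b" for x
    using that by (auto simp: compose_def restrict_def)
  from * obtain h where "h \<in> T \<rightarrow>\<^sub>E P" "compose T p h = (\<lambda>_\<in>T. a)" "compose T q h = (\<lambda>_\<in>T. b)"
    by blast
  then have "h undefined \<in> P" "p (h undefined) = a" "q (h undefined) = b"
    by (auto simp: T_def compose_def PiE_iff dest!: fun_cong[where x = undefined])
  moreover have "x = y" if "x \<in> P \<and> p x = a \<and> q x = b" "y \<in> P \<and> p y = a \<and> q y = b" for x y
  proof -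
    have "(\<lambda>_\<in>T. x) = (\<lambda>_\<in>T. y)"
      using * point that by blast
    from fun_cong[OF this, of undefined] show ?thesis
      by (simp add: T_def)
  qed
  ultimately show ?thesis
    by blast
qed

section \<open>Consequences of tautness\<close>

lemma taut_is_functor: "taut U F \<Longrightarrow> is_functor U F"
  by (simp add: taut_def)

lemma taut_pullback:
  assumes "taut U F" "P \<in> U" "A \<in> U" "B \<in> U" "C \<in> U"
    and "is_pullback U P A B C p q f m" "inj_on m B"
  shows "is_pullback UNIV (fobj F P) (fobj F A) (fobj F B) (fobj F C)
          (fmap F P A p) (fmap F P B q) (fmap F A C f) (fmap F B C m)"
  using assms unfolding taut_def by blast

text \<open>Injectivity of \<open>m\<close> means that its kernel pair is trivial, that is, the
  square with two identities over \<open>m\<close> and \<open>m\<close> is a pullback. One leg is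
  mono, so tautness preserves this square; two points with equal image then have a common preimage
  under identities.\<close>

lemma taut_fmap_inj_on:
  assumes "taut U F" "X \<in> U" "Y \<in> U" "m \<in> X \<rightarrow>\<^sub>E Y" "inj_on m X"
  shows "inj_on (fmap F X Y m) (fobj F X)"
proof (rule inj_onI)
  fix x y
  assume xy: "x \<in> fobj F X" "y \<in> fobj F X" "fmap F X Y m x = fmap F X Y m y"
  let ?i = "restrict id X"
  have "is_pullback U X X X Y ?i ?i m m"
    using assms by (intro is_pullbackI) (auto dest: inj_onD)
  from is_pullback_UNIV_ex1[OF taut_pullback[OF assms(1,2,2,2,3) this assms(5)] xy]
  show "x = y"
    using fmap_id[OF taut_is_functor[OF assms(1)] assms(2)] by auto
qed

section \<open>Adjoining a point\<close>

lemma plus_one_cases: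
  assumes "z \<in> plus_one X"
  obtains "z = opt_code None" | x where "x \<in> X" "z = opt_code (Some x)"
  using assms by (auto simp: plus_one_def)

lemma opt_code_in_plus_one [simp]:
  "opt_code None \<in> plus_one X" "opt_code (Some x) \<in> plus_one X \<longleftrightarrow> x \<in> X"
  by (auto simp: plus_one_def inj_eq[OF inj_opt_code])

lemma plus_one_map_Some: "x \<in> X \<Longrightarrow> plus_one_map X f (opt_code (Some x)) = opt_code (Some (f x))"
  by (simp add: plus_one_map_def inv_f_f[OF inj_opt_code])

lemma plus_one_map_funcset:
  assumes "f \<in> X \<rightarrow> Y"
  shows "plus_one_map X f \<in> plus_one X \<rightarrow>\<^sub>E plus_one Y"
proof (rule PiE_I)
  fix z
  assume "z \<in> plus_one X"
  then show "plus_one_map X f z \<in> plus_one Y"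
    by (cases rule: plus_one_cases)
       (use assms in \<open>auto simp: plus_one_map_point plus_one_map_Some\<close>)
qed (simp add: plus_one_map_def)

text \<open>The uniqueness half of the universal property of X + 1. The functor laws for the passage
  from f to f + 1 follow from it.\<close>

lemma plus_one_map_eqI:
  assumes "g \<in> extensional (plus_one X)" "g (opt_code None) = opt_code None"
    and "\<And>x. x \<in> X \<Longrightarrow> g (opt_code (Some x)) = opt_code (Some (f x))"
  shows "plus_one_map X f = g"
proof (rule extensionalityI)
  fix z
  assume "z \<in> plus_one X"
  then show "plus_one_map X f z = g z"
    by (cases rule: plus_one_cases)
       (simp_all add: assms plus_one_map_point plus_one_map_Some)
qed (use assms(1) in \<open>simp_all add: plus_one_map_def\<close>)

lemma plus_one_inj_funcset: "plus_one_inj X \<in> X \<rightarrow>\<^sub>E plus_one X"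
  by (simp add: plus_one_inj_def)

lemma inj_on_plus_one_inj: "inj_on (plus_one_inj X) X"
  by (auto simp: inj_on_def plus_one_inj_def inj_eq[OF inj_opt_code])

lemma plus_one_map_id: "plus_one_map X (restrict id X) = restrict id (plus_one X)"
  by (rule plus_one_map_eqI) simp_all

lemma plus_one_map_compose:
  assumes "f \<in> X \<rightarrow> Y"
  shows "plus_one_map X (compose X g f) =
     compose (plus_one X) (plus_one_map Y g) (plus_one_map X f)"
proof (rule plus_one_map_eqI)
  fix x
  assume "x \<in> X"
  moreover have "f x \<in> Y"
    using assms \<open>x \<in> X\<close> by auto
  ultimately show "compose (plus_one X) (plus_one_map Y g) (plus_one_map X f) (opt_code (Some x)) =
      opt_code (Some (compose X g f x))"
    by (simp add: compose_eq plus_one_map_Some)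
qed (simp_all add: compose_eq plus_one_map_point)

text \<open>Since f + 1 fixes the added point, only points of X can land in the image of j_Y. This
  is the inverse image diagram to which tautness is applied below.\<close>

lemma is_pullback_plus_one:
  assumes "f \<in> X \<rightarrow>\<^sub>E Y"
  shows "is_pullback U X (plus_one X) Y (plus_one Y)
           (plus_one_inj X) f (plus_one_map X f) (plus_one_inj Y)"
proof (rule is_pullbackI)
  show "plus_one_map X f \<in> plus_one X \<rightarrow>\<^sub>E plus_one Y"
    using assms plus_one_map_funcset by blast
  show "plus_one_map X f (plus_one_inj X x) = plus_one_inj Y (f x)" if "x \<in> X" for x
    using assms that by (auto simp: plus_one_map_Some plus_one_inj_def)
  show "\<exists>!x. x \<in> X \<and> plus_one_inj X x = z \<and> f x = y"
    if "z \<in> plus_one X" "y \<in> Y" "plus_one_map X f z = plus_one_inj Y y" for z y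
    using that(1)
  proof (cases rule: plus_one_cases)
    \<comment> \<open>The added point is sent to the added point, which is outside the image of j_Y,
      so this case is contradictory.\<close>
    case 1
    then show ?thesis
      using that by (simp add: plus_one_map_point plus_one_inj_def inj_eq[OF inj_opt_code])
  next
    case (2 x)
    then have "f x = y"
      using that by (simp add: plus_one_map_Some plus_one_inj_def inj_eq[OF inj_opt_code])
    with 2 show ?thesis
      by (intro ex1I[of _ x]) (auto simp: plus_one_inj_def inj_eq[OF inj_opt_code])
  qed
qed (use assms plus_one_inj_funcset in auto)

section \<open>Functoriality of the constructions\<close>

lemma is_functor_prod:
  assumes "\<And>i. i \<in> I \<Longrightarrow> is_functor U (F i)"
  shows "is_functor U (functor_prod I F)"
proof (rule is_functorI, goal_cases)
  case (1 X Y f)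
  then show ?case
    using fmap_in[OF assms] by (auto simp: functor_prod_def PiE_iff)
next
  case (2 X x)
  then show ?case
    using fmap_id[OF assms]
    by (auto simp: functor_prod_def intro!: extensionalityI[where A = I] simp: PiE_iff)
next
  case (3 X Y Z f g x)
  then show ?case
    using fmap_compose[OF assms] fmap_in[OF assms]
    by (auto simp: functor_prod_def PiE_iff intro!: restrict_ext)
qed

lemma is_functor_times:
  assumes F: "is_functor U F" and G: "is_functor U G"
  shows "is_functor U (functor_times F G)"
proof (rule is_functorI, goal_cases)
  case (1 X Y f)
  then show ?case
    by (auto simp: functor_times_def PiE_iff fmap_in[OF F] fmap_in[OF G])
next
  case (2 X x)
  then show ?case
    by (auto simp: functor_times_def fmap_id[OF F] fmap_id[OF G])
next
  case (3 X Y Z f g x)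
  then show ?case
    by (auto simp: functor_times_def fmap_compose[OF F] fmap_compose[OF G] fmap_in[OF F]
        fmap_in[OF G])
qed

lemma is_functor_sum:
  assumes "\<And>k. k \<in> K \<Longrightarrow> is_functor U (G k)"
  shows "is_functor U (functor_sum K G)"
proof (rule is_functorI, goal_cases)
  case (1 X Y f)
  then show ?case
    by (auto simp: functor_sum_def PiE_iff fmap_in[OF assms])
next
  case (2 X x)
  then show ?case
    by (auto simp: functor_sum_def fmap_id[OF assms])
next
  case (3 X Y Z f g x)
  then show ?case
    by (auto simp: functor_sum_def fmap_compose[OF assms] fmap_in[OF assms])
qed

text \<open>Pullbacks of sets are formed coordinatewise: by the pointwise criterion, the unique
  points supplied by the factors assemble into a unique tuple. Tautness of the product is what makes
  its difference functor a functor.\<close>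

lemma taut_prod:
  assumes taut: "\<And>i. i \<in> I \<Longrightarrow> taut U (F i)"
  shows "taut U (functor_prod I F)"
  unfolding taut_def
proof (intro conjI ballI allI impI)
  let ?F = "functor_prod I F"
  show prod: "is_functor U ?F"
    by (intro is_functor_prod taut_is_functor taut)
  fix P A B C p q f m
  assume U: "P \<in> U" "A \<in> U" "B \<in> U" "C \<in> U"
    and "is_pullback U P A B C p q f m \<and> inj_on m B"
  then have pb: "is_pullback U P A B C p q f m" and inj: "inj_on m B"
    by auto
  then have funs: "p \<in> P \<rightarrow>\<^sub>E A" "q \<in> P \<rightarrow>\<^sub>E B" "f \<in> A \<rightarrow>\<^sub>E C" "m \<in> B \<rightarrow>\<^sub>E C"
    by (auto simp: is_pullback_def)
  have pb_i: "is_pullback UNIV (fobj (F i) P) (fobj (F i) A) (fobj (F i) B) (fobj (F i) C)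
      (fmap (F i) P A p) (fmap (F i) P B q) (fmap (F i) A C f) (fmap (F i) B C m)"
    if "i \<in> I" for i
    using taut_pullback[OF taut[OF that] U pb inj] .
  note in_i = fmap_in[OF taut_is_functor[OF taut]]
  have fmap_eq: "fmap ?F X Y g x = (\<lambda>i\<in>I. fmap (F i) X Y g (x i))"
    if "\<And>i. i \<in> I \<Longrightarrow> x i \<in> fobj (F i) X" "x \<in> extensional I" for X Y g x
    using that by (simp add: functor_prod_def PiE_iff)
  have fobj_iff: "x \<in> fobj ?F X \<longleftrightarrow> (\<forall>i\<in>I. x i \<in> fobj (F i) X) \<and> x \<in> extensional I" for X x
    by (simp add: functor_prod_def PiE_iff)
  show "is_pullback UNIV (fobj ?F P) (fobj ?F A) (fobj ?F B) (fobj ?F C)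
      (fmap ?F P A p) (fmap ?F P B q) (fmap ?F A C f) (fmap ?F B C m)"
  proof (rule is_pullbackI)
    fix x
    assume x: "x \<in> fobj ?F P"
    have "fmap ?F A C f (fmap ?F P A p x) = (\<lambda>i\<in>I. fmap (F i) A C f (fmap (F i) P A p (x i)))"
      using x U funs in_i[OF _ U(1,2) funs(1)] by (simp add: fobj_iff fmap_eq cong: restrict_cong)
    also have "\<dots> = (\<lambda>i\<in>I. fmap (F i) B C m (fmap (F i) P B q (x i)))"
      using x is_pullback_commute[OF pb_i] by (intro restrict_ext) (simp add: fobj_iff)
    also have "\<dots> = fmap ?F B C m (fmap ?F P B q x)"
      using x U funs in_i[OF _ U(1,3) funs(2)] by (simp add: fobj_iff fmap_eq cong: restrict_cong)
    finally show "fmap ?F A C f (fmap ?F P A p x) = fmap ?F B C m (fmap ?F P B q x)" .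
  next
    fix a b
    assume a: "a \<in> fobj ?F A" and b: "b \<in> fobj ?F B" and eq: "fmap ?F A C f a = fmap ?F B C m b"
    have "\<exists>!x. x \<in> fobj (F i) P \<and> fmap (F i) P A p x = a i \<and> fmap (F i) P B q x = b i"
      if i: "i \<in> I" for i
    proof (rule is_pullback_UNIV_ex1[OF pb_i[OF i]])
      show "fmap (F i) A C f (a i) = fmap (F i) B C m (b i)"
        using a b i fun_cong[OF eq, of i] by (simp add: fobj_iff fmap_eq)
    qed (use a b i in \<open>simp_all add: fobj_iff\<close>)
    \<comment> \<open>Choice over \<open>I\<close> collects the coordinates into one family;
      \<open>uniq\<close> retains their uniqueness for the comparison with a competing
      tuple.\<close>
    then obtain x where x: "\<And>i. i \<in> I \<Longrightarrow>
        x i \<in> fobj (F i) P \<and> fmap (F i) P A p (x i) = a i \<and> fmap (F i) P B q (x i) = b i"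
      and uniq: "\<And>i y. i \<in> I \<Longrightarrow> y \<in> fobj (F i) P \<Longrightarrow> fmap (F i) P A p y = a i \<Longrightarrow>
        fmap (F i) P B q y = b i \<Longrightarrow> y = x i"
      by metis
    show "\<exists>!x. x \<in> fobj ?F P \<and> fmap ?F P A p x = a \<and> fmap ?F P B q x = b"
    proof (rule ex1I[of _ "restrict x I"])
      have "(\<lambda>i\<in>I. fmap (F i) P A p (x i)) = a" "(\<lambda>i\<in>I. fmap (F i) P B q (x i)) = b"
        using a b x by (auto simp: fobj_iff intro!: extensionalityI[where A = I])
      then show "restrict x I \<in> fobj ?F P \<and> fmap ?F P A p (restrict x I) = a \<and>
          fmap ?F P B q (restrict x I) = b"
        using x by (simp add: fobj_iff fmap_eq cong: restrict_cong)
    next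
      fix y
      assume y: "y \<in> fobj ?F P \<and> fmap ?F P A p y = a \<and> fmap ?F P B q y = b"
      show "y = restrict x I"
      proof (rule extensionalityI[where A = I])
        fix i
        assume i: "i \<in> I"
        have "fmap (F i) P A p (y i) = a i" "fmap (F i) P B q (y i) = b i"
          using y i by (auto simp: fobj_iff fmap_eq)
        with y i uniq[OF i, of "y i"] show "y i = restrict x I i"
          by (simp add: fobj_iff)
      qed (use y in \<open>simp_all add: fobj_iff\<close>)
    qed
  qed (intro fmap_funcset[OF prod] U funs)+
qed

section \<open>The difference functor of a taut functor\<close>

lemma fobj_difference:
  "fobj (\<Delta> F) X = fobj F (plus_one X) - fmap F X (plus_one X) (plus_one_inj X) ` fobj F X"
  by (simp add: difference_functor_def Let_def)

lemma fmap_difference: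
  "x \<in> fobj (\<Delta> F) X \<Longrightarrow> fmap (\<Delta> F) X Y f x = fmap F (plus_one X) (plus_one Y) (plus_one_map X f) x"
  by (simp add: difference_functor_def Let_def)

context
  fixes U :: "'a::infinite set set" and F :: "('a, 'b) set_functor"
  assumes U: "set_universe U" and taut: "taut U F"
begin

lemma inj_on_fmap_plus_one_inj:
  "X \<in> U \<Longrightarrow> inj_on (fmap F X (plus_one X) (plus_one_inj X)) (fobj F X)"
  by (intro taut_fmap_inj_on[OF taut] plus_one_in_universe[OF U] plus_one_inj_funcset
      inj_on_plus_one_inj)

context
  fixes X Y :: "'a set" and f :: "'a \<Rightarrow> 'a"
  assumes X: "X \<in> U" and Y: "Y \<in> U" and f: "f \<in> X \<rightarrow>\<^sub>E Y"
begin

lemma taut_plus_one_pullback: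
  "is_pullback UNIV (fobj F X) (fobj F (plus_one X)) (fobj F Y) (fobj F (plus_one Y))
     (fmap F X (plus_one X) (plus_one_inj X)) (fmap F X Y f)
     (fmap F (plus_one X) (plus_one Y) (plus_one_map X f)) (fmap F Y (plus_one Y) (plus_one_inj Y))"
  by (intro taut_pullback[OF taut] is_pullback_plus_one plus_one_in_universe[OF U]
      inj_on_plus_one_inj X Y f)

text \<open>Commutativity of the square: F(f+1) after F(j_X) equals F(j_Y) after F(f), so the maps
  F(j_X) are natural in X.\<close>

lemmas fmap_plus_one_natural = is_pullback_commute[OF taut_plus_one_pullback]

text \<open>From right to left this is naturality of F(j). From left to right, \<open>z\<close> and
  the given point of F(Y) form a compatible pair, and the pullback supplies a point of F(X) over
  \<open>z\<close>.\<close>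

lemma fmap_plus_one_in_image_iff:
  assumes "z \<in> fobj F (plus_one X)"
  shows "fmap F (plus_one X) (plus_one Y) (plus_one_map X f) z
           \<in> fmap F Y (plus_one Y) (plus_one_inj Y) ` fobj F Y \<longleftrightarrow>
         z \<in> fmap F X (plus_one X) (plus_one_inj X) ` fobj F X"
  using is_pullback_UNIV_ex1[OF taut_plus_one_pullback assms] fmap_plus_one_natural
    fmap_in[OF taut_is_functor[OF taut] X Y f]
  by (smt (verit, best) image_iff)

end

text \<open>F(f+1) reflects membership in the images, so points outside the image of F(j_X) stay
  outside that of F(j_Y).\<close>

lemma fmap_difference_funcset:
  assumes "X \<in> U" "Y \<in> U" "f \<in> X \<rightarrow>\<^sub>E Y"
  shows "fmap (\<Delta> F) X Y f \<in> fobj (\<Delta> F) X \<rightarrow>\<^sub>E fobj (\<Delta> F) Y"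
proof -
  have "fmap (\<Delta> F) X Y f x \<in> fobj (\<Delta> F) Y" if x: "x \<in> fobj (\<Delta> F) X" for x
  proof -
    have "plus_one_map X f \<in> plus_one X \<rightarrow>\<^sub>E plus_one Y"
      using assms plus_one_map_funcset by blast
    then show ?thesis
      using x fmap_plus_one_in_image_iff[OF assms, of x] assms plus_one_in_universe[OF U]
        fmap_in[OF taut_is_functor[OF taut], of "plus_one X" "plus_one Y" "plus_one_map X f" x]
      unfolding fmap_difference[OF x] by (simp add: fobj_difference)
  qed
  moreover have "fmap (\<Delta> F) X Y f \<in> extensional (fobj (\<Delta> F) X)"
    by (simp add: difference_functor_def Let_def)
  ultimately show ?thesis
    by (simp add: PiE_iff)
qed

lemma is_functor_difference: "is_functor U (\<Delta> F)"
proof (rule is_functorI[OF fmap_difference_funcset])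
  note F = taut_is_functor[OF taut]
  show "fmap (\<Delta> F) X X (restrict id X) x = x" if "X \<in> U" "x \<in> fobj (\<Delta> F) X" for X x
    using that fmap_id[OF F plus_one_in_universe[OF U]]
    by (simp add: fmap_difference plus_one_map_id) (simp add: fobj_difference)
  show "fmap (\<Delta> F) X Z (compose X g f) x = fmap (\<Delta> F) Y Z g (fmap (\<Delta> F) X Y f x)"
    if U': "X \<in> U" "Y \<in> U" "Z \<in> U" and f: "f \<in> X \<rightarrow>\<^sub>E Y" and g: "g \<in> Y \<rightarrow>\<^sub>E Z"
      and x: "x \<in> fobj (\<Delta> F) X" for X Y Z f g x
  proof -
    \<comment> \<open>The value of a \<Delta>-map is known only at points of the difference, so
      evaluating the outer map needs this membership.\<close>
    have "fmap (\<Delta> F) X Y f x \<in> fobj (\<Delta> F) Y"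
      using fmap_difference_funcset[OF U'(1,2) f] x by blast
    moreover have "plus_one_map X f \<in> plus_one X \<rightarrow>\<^sub>E plus_one Y"
        "plus_one_map Y g \<in> plus_one Y \<rightarrow>\<^sub>E plus_one Z"
      using f g plus_one_map_funcset by blast+
    moreover have "x \<in> fobj F (plus_one X)"
      using x by (simp add: fobj_difference)
    moreover have "plus_one_map X (compose X g f) =
        compose (plus_one X) (plus_one_map Y g) (plus_one_map X f)"
      using f by (intro plus_one_map_compose) auto
    ultimately show ?thesis
      using x U' plus_one_in_universe[OF U] by (simp add: fmap_difference fmap_compose[OF F])
  qed
qed

end

section \<open>The isomorphism\<close>

definition image_support ::
  "'i set \<Rightarrow> ('i \<Rightarrow> ('a::infinite, 'b) set_functor) \<Rightarrow> 'a set \<Rightarrow> ('i \<Rightarrow> 'b) \<Rightarrow> 'i set" where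
  "image_support I F X x =
     {i \<in> I. x i \<in> fmap (F i) X (plus_one X) (plus_one_inj X) ` fobj (F i) X}"

text \<open>The component at X of the isomorphism. Coordinates in \<open>J\<close> lie in the image
  of F_j(j_X) and are pulled back to F_j(X); the others already lie in \<Delta>[F_k](X) by the
  choice of \<open>J\<close> and are kept.\<close>

definition split_support ::
  "'i set \<Rightarrow> ('i \<Rightarrow> ('a::infinite, 'b) set_functor) \<Rightarrow> 'a set \<Rightarrow>
     ('i \<Rightarrow> 'b) \<Rightarrow> 'i set \<times> ('i \<Rightarrow> 'b) \<times> ('i \<Rightarrow> 'b)" where
  "split_support I F X x =
     (let J = image_support I F X x
      in (J,
          \<lambda>j\<in>J. inv_into (fobj (F j) X) (fmap (F j) X (plus_one X) (plus_one_inj X)) (x j),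
          restrict x (I - J)))"

text \<open>The product map acts coordinatewise, so a preimage of \<open>x\<close> is a choice of
  preimages of all its coordinates.\<close>

lemma fobj_difference_prod_iff:
  "x \<in> fobj (\<Delta> (functor_prod I F)) X \<longleftrightarrow>
     x \<in> (\<Pi>\<^sub>E i\<in>I. fobj (F i) (plus_one X)) \<and> image_support I F X x \<subset> I"
proof -
  have "x \<in> fmap (functor_prod I F) X (plus_one X) (plus_one_inj X) ` fobj (functor_prod I F) X
      \<longleftrightarrow> image_support I F X x = I"
    if x: "x \<in> (\<Pi>\<^sub>E i\<in>I. fobj (F i) (plus_one X))"
  proof
    assume "image_support I F X x = I"
    then have "\<forall>i\<in>I. \<exists>y. y \<in> fobj (F i) X \<and>
        x i = fmap (F i) X (plus_one X) (plus_one_inj X) y"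
      by (auto simp: image_support_def)
    then obtain y where y: "\<And>i. i \<in> I \<Longrightarrow> y i \<in> fobj (F i) X \<and>
        x i = fmap (F i) X (plus_one X) (plus_one_inj X) (y i)"
      by metis
    then show "x \<in> fmap (functor_prod I F) X (plus_one X) (plus_one_inj X) `
        fobj (functor_prod I F) X"
      using x
      by (intro image_eqI[of _ _ "restrict y I"])
         (auto simp: functor_prod_def PiE_iff intro!: extensionalityI[where A = I])
  qed (auto simp: image_support_def functor_prod_def PiE_iff)
  moreover have "image_support I F X x \<subseteq> I"
    by (auto simp: image_support_def)
  ultimately show ?thesis
    by (auto simp: fobj_difference functor_prod_def)
qed

context
  fixes U :: "'a::infinite set set" and I :: "'i set" and F :: "'i \<Rightarrow> ('a, 'b) set_functor"
  assumes U: "set_universe U" and taut: "\<And>i. i \<in> I \<Longrightarrow> taut U (F i)"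
begin

lemma bij_betw_split_support:
  assumes X: "X \<in> U"
  shows "bij_betw (split_support I F X) (fobj (\<Delta> (functor_prod I F)) X)
     (SIGMA J:{J. J \<subset> I}. (\<Pi>\<^sub>E j\<in>J. fobj (F j) X) \<times> (\<Pi>\<^sub>E k\<in>I - J. fobj (\<Delta> (F k)) X))"
    (is "bij_betw _ ?D ?S")
proof -
  let ?m = "\<lambda>i. fmap (F i) X (plus_one X) (plus_one_inj X)"
  \<comment> \<open>The inverse map: push the coordinates in \<open>J\<close> forward along F_i(j_X)
    and take the remaining ones from \<open>z\<close>.\<close>
  let ?join = "\<lambda>(J, y, z). \<lambda>i\<in>I. if i \<in> J then ?m i (y i) else z i"
  note inj = inj_on_fmap_plus_one_inj[OF U taut X]
  have m: "?m i y \<in> fobj (F i) (plus_one X)" if "i \<in> I" "y \<in> fobj (F i) X" for i y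
    using fmap_in[OF taut_is_functor[OF taut] X plus_one_in_universe[OF U X] plus_one_inj_funcset]
      that by blast
  \<comment> \<open>No coordinate outside \<open>J\<close> is in the image, because \<open>z\<close>
    takes its values in the differences. Hence the label \<open>J\<close> is recovered, and its
    properness puts the joined point in \<open>?D\<close>.\<close>
  have supp: "image_support I F X (?join (J, y, z)) = J" if "(J, y, z) \<in> ?S" for J y z
    using that by (auto simp: image_support_def fobj_difference PiE_iff)
  show ?thesis
  proof (rule bij_betwI[where g = ?join])
    show "split_support I F X \<in> ?D \<rightarrow> ?S"
    proof
      fix x
      assume "x \<in> ?D"
      then have "x \<in> (\<Pi>\<^sub>E i\<in>I. fobj (F i) (plus_one X))" "image_support I F X x \<subset> I"
        by (simp_all add: fobj_difference_prod_iff)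
      then show "split_support I F X x \<in> ?S"
        by (auto simp: split_support_def Let_def PiE_iff fobj_difference image_support_def
            intro: inv_into_into)
    qed
    show "?join \<in> ?S \<rightarrow> ?D"
    proof
      fix s
      assume s: "s \<in> ?S"
      obtain J y z where s_eq: "s = (J, y, z)"
        by (cases s) auto
      show "?join s \<in> ?D"
        unfolding fobj_difference_prod_iff
      proof
        have "image_support I F X (?join s) = J"
          using supp s unfolding s_eq .
        then show "image_support I F X (?join s) \<subset> I"
          using s by (simp add: s_eq)
        show "?join s \<in> (\<Pi>\<^sub>E i\<in>I. fobj (F i) (plus_one X))"
          using s m by (auto simp: s_eq PiE_iff fobj_difference)
      qed
    qed
    show "?join (split_support I F X x) = x" if "x \<in> ?D" for x
      using that
      by (auto simp: fobj_difference_prod_iff split_support_def Let_def PiE_iff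
          image_support_def f_inv_into_f intro!: extensionalityI[where A = I])
    show "split_support I F X (?join s) = s" if s: "s \<in> ?S" for s
    proof -
      obtain J y z where s_eq: "s = (J, y, z)"
        by (cases s) auto
      have y: "y \<in> (\<Pi>\<^sub>E j\<in>J. fobj (F j) X)" and z: "z \<in> extensional (I - J)" and J: "J \<subseteq> I"
        using s by (auto simp: s_eq PiE_iff)
      \<comment> \<open>Injectivity of F_j(j_X), hence tautness, enters here:
        \<open>inv_into\<close> must return \<open>y\<close> itself and not merely some preimage
        with the same image.\<close>
      have "(\<lambda>j\<in>J. inv_into (fobj (F j) X) (?m j) (?join s j)) = y"
        using y J inj
        by (intro extensionalityI[where A = J]) (auto simp: s_eq PiE_iff subset_iff)
      moreover have "restrict (?join s) (I - J) = z"
        using z by (intro extensionalityI[where A = "I - J"]) (auto simp: s_eq)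
      ultimately show ?thesis
        using supp s by (simp add: split_support_def Let_def s_eq)
    qed
  qed
qed

text \<open>The label is unchanged because F_i(f+1) preserves and reflects the images. On
  \<open>J\<close>, naturality of F(j) lets the inverses pass across f; off \<open>J\<close>, both
  sides apply F_k(f+1).\<close>

lemma split_support_natural:
  assumes X: "X \<in> U" and Y: "Y \<in> U" and f: "f \<in> X \<rightarrow>\<^sub>E Y"
    and x: "x \<in> fobj (\<Delta> (functor_prod I F)) X"
  shows "split_support I F Y (fmap (\<Delta> (functor_prod I F)) X Y f x) =
     fmap (functor_sum {J. J \<subset> I} (\<lambda>J. functor_times (functor_prod J F)
       (functor_prod (I - J) (\<lambda>k. \<Delta> (F k))))) X Y f (split_support I F X x)"
proof -
  let ?m = "\<lambda>X i. fmap (F i) X (plus_one X) (plus_one_inj X)"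
  let ?f1 = "\<lambda>i. fmap (F i) (plus_one X) (plus_one Y) (plus_one_map X f)"
  define J where "J = image_support I F X x"
  have x': "x \<in> (\<Pi>\<^sub>E i\<in>I. fobj (F i) (plus_one X))"
    using x by (simp add: fobj_difference_prod_iff)
  have fx: "fmap (\<Delta> (functor_prod I F)) X Y f x = (\<lambda>i\<in>I. ?f1 i (x i))"
    unfolding fmap_difference[OF x] using x' by (simp add: functor_prod_def)
  have J_Y: "image_support I F Y (\<lambda>i\<in>I. ?f1 i (x i)) = J"
    using fmap_plus_one_in_image_iff[OF U taut X Y f] x'
    by (auto simp: J_def image_support_def PiE_iff)
  \<comment> \<open>Write x_j as F_j(j_X)(y). Naturality turns its image under F_j(f+1) into
    F_j(j_Y)(F_j(f)(y)), and injectivity on both sides evaluates the two inverses to F_j(f)(y) and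
    y.\<close>
  have inv: "inv_into (fobj (F j) Y) (?m Y j) (?f1 j (x j)) =
      fmap (F j) X Y f (inv_into (fobj (F j) X) (?m X j) (x j))" if "j \<in> J" for j
  proof -
    have j: "j \<in> I"
      using that by (simp add: J_def image_support_def)
    obtain y where y: "y \<in> fobj (F j) X" "x j = ?m X j y"
      using \<open>j \<in> J\<close> by (auto simp: J_def image_support_def)
    have "?f1 j (x j) = ?m Y j (fmap (F j) X Y f y)"
      using fmap_plus_one_natural[OF U taut[OF j] X Y f y(1)] y(2) by simp
    then show ?thesis
      using y fmap_in[OF taut_is_functor[OF taut[OF j]] X Y f y(1)]
        inj_on_fmap_plus_one_inj[OF U taut[OF j] X] inj_on_fmap_plus_one_inj[OF U taut[OF j] Y]
      by simp
  qed
  define y where "y = (\<lambda>j\<in>J. inv_into (fobj (F j) X) (?m X j) (x j))"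
  define z where "z = restrict x (I - J)"
  have split: "split_support I F X x = (J, y, z)"
    by (simp add: split_support_def J_def y_def z_def Let_def)
  \<comment> \<open>Well-definedness of the bijection gives the memberships under which the
    restricted maps of sum and product can be evaluated.\<close>
  have "(J, y, z) \<in> (SIGMA J:{J. J \<subset> I}. (\<Pi>\<^sub>E j\<in>J. fobj (F j) X) \<times>
      (\<Pi>\<^sub>E k\<in>I - J. fobj (\<Delta> (F k)) X))"
    using bij_betw_apply[OF bij_betw_split_support[OF X] x] unfolding split .
  then have mem: "J \<subset> I" "y \<in> (\<Pi>\<^sub>E j\<in>J. fobj (F j) X)"
      "z \<in> (\<Pi>\<^sub>E k\<in>I - J. fobj (\<Delta> (F k)) X)"
    by auto
  have "fmap (functor_sum {J. J \<subset> I} (\<lambda>J. functor_times (functor_prod J F)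
      (functor_prod (I - J) (\<lambda>k. \<Delta> (F k))))) X Y f (J, y, z) =
      (J, \<lambda>j\<in>J. fmap (F j) X Y f (y j), \<lambda>k\<in>I - J. fmap (\<Delta> (F k)) X Y f (z k))"
    using mem by (simp add: functor_sum_def functor_times_def functor_prod_def)
  also have "(\<lambda>j\<in>J. fmap (F j) X Y f (y j)) =
      (\<lambda>j\<in>J. inv_into (fobj (F j) Y) (?m Y j) ((\<lambda>i\<in>I. ?f1 i (x i)) j))"
    using inv mem(1) by (intro restrict_ext) (auto simp: y_def)
  also have "(\<lambda>k\<in>I - J. fmap (\<Delta> (F k)) X Y f (z k)) = restrict (\<lambda>i\<in>I. ?f1 i (x i)) (I - J)"
  proof
    fix k
    show "(\<lambda>k\<in>I - J. fmap (\<Delta> (F k)) X Y f (z k)) k = restrict (\<lambda>i\<in>I. ?f1 i (x i)) (I - J) k"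
      using PiE_mem[OF mem(3), of k] by (auto simp: fmap_difference z_def)
  qed
  finally show ?thesis
    unfolding fx split by (simp only: split_support_def J_Y Let_def)
qed

end

theorem theorem3p2p8:
  fixes U :: "'a::infinite set set"
    and I :: "'i set"
    and F :: "'i \<Rightarrow> ('a, 'b) set_functor"
  assumes "set_universe U"
    and "\<And>i. i \<in> I \<Longrightarrow> taut U (F i)"
  shows "functors_isomorphic U
           (\<Delta> (functor_prod I F))
           (functor_sum {J. J \<subset> I}
             (\<lambda>J. functor_times (functor_prod J F) (functor_prod (I - J) (\<lambda>k. \<Delta> (F k)))))"
    (is "functors_isomorphic U ?D ?S")
proof -
  have "is_functor U ?D"
    using assms by (intro is_functor_difference taut_prod)
  moreover have "is_functor U ?S"
    using assms
    by (intro is_functor_sum is_functor_times is_functor_prod is_functor_difference)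
       (auto simp: taut_is_functor)
  moreover have "bij_betw (split_support I F X) (fobj ?D X) (fobj ?S X)" if "X \<in> U" for X
    using bij_betw_split_support[OF assms that]
    by (simp add: functor_sum_def functor_times_def functor_prod_def)
  ultimately show ?thesis
    unfolding functors_isomorphic_def
    by (intro conjI exI[of _ "split_support I F"] ballI split_support_natural[OF assms])
qed

end
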